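(* Let $p$ be an odd prime, $v$ an $n$-dimensional integral vector, and $Q$ an $n\times n$ primitive matrix generated from $v$. Then every $n\times n$ primitive matrix generated from $v$ can be obtained from $Q$ by a permutation of its columns.
   Context: An orthogonal matrix $Q$ is regular if $Qe=e$, where $e$ is the all-one vector. The level of a rational matrix $Q$ is the smallest positive integer $k$ with $kQ$ integral. A primitive matrix is a regular rational orthogonal matrix $Q$ of level $p$ such that $pQ$ has rank $1$ over $\mathbb{F}_p=\mathbb{Z}/p\mathbb{Z}$. A primitive matrix $Q$ is generated from an integral vector $v$ if each column of $pQ$ is a multiple of $v$ over $\mathbb{F}_p$. *)

theory Defs
  imports "HOL-Analysis.Analysis" "HOL-Combinatorics.Permutations"
    "Berlekamp_Zassenhaus.Finite_Field"
begin

definition regular_matrix :: "rat^'n^'n \<Rightarrow> bool" where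
  "regular_matrix Q \<longleftrightarrow> Q *v 1 = 1"

definition level :: "rat^'n^'n \<Rightarrow> nat" where
  "level Q = (LEAST k. k > 0 \<and> (\<forall>i j. of_nat k * Q $ i $ j \<in> \<int>))"

text \<open>The reduction modulo \<open>p = CARD('p)\<close> of the matrix \<open>p Q\<close>. It is only meaningful if
  \<open>p Q\<close> is integral, e.g. if \<open>Q\<close> has level \<open>p\<close>; the floor is then exact.\<close>

definition scaled_mod :: "rat^'n^'n \<Rightarrow> 'p::prime_card mod_ring^'n^'n" where
  "scaled_mod Q = (\<chi> i j. of_int \<lfloor>of_nat CARD('p) * Q $ i $ j\<rfloor>)"

text \<open>The prime \<open>p\<close> is represented by a type \<open>'p\<close> with \<open>CARD('p) = p\<close>, so that the field with
  \<open>p\<close> elements is the type \<open>'p mod_ring\<close>. Rational matrices are matrices over \<open>rat\<close>.\<close>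

definition primitive_matrix :: "'p::prime_card itself \<Rightarrow> rat^'n^'n \<Rightarrow> bool" where
  "primitive_matrix _ Q \<longleftrightarrow>
     orthogonal_matrix Q \<and> regular_matrix Q \<and> level Q = CARD('p) \<and>
     rank (scaled_mod Q :: 'p mod_ring^'n^'n) = 1"

definition generated_from :: "'p::prime_card itself \<Rightarrow> rat^'n^'n \<Rightarrow> int^'n \<Rightarrow> bool" where
  "generated_from _ Q v \<longleftrightarrow>
     (\<forall>j. \<exists>c :: 'p mod_ring. column j (scaled_mod Q) = c *s (\<chi> i. of_int (v $ i)))"

end

theory Submission
  imports Defs
begin

text \<open>Write \<open>M = p Q\<close>, \<open>M' = p Q'\<close>. The matrix \<open>U = Q\<^sup>T Q'\<close> is orthogonal and fixes the all-one
  vector, so it is a permutation matrix as soon as it is integral, and \<open>Q' = Q U\<close>. Integrality means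
  that \<open>p\<^sup>2\<close> divides every inner product of a column of \<open>M\<close> with a column of \<open>M'\<close>. If \<open>w\<close>, \<open>w'\<close> are
  columns of \<open>M\<close>, \<open>M'\<close> that do not vanish modulo \<open>p\<close>, then \<open>w' = e w + p t\<close> with \<open>e\<close> a unit
  modulo \<open>p\<close>, and \<open>w \<bullet> w = w' \<bullet> w' = p\<^sup>2\<close> forces \<open>p\<close> to divide \<open>2 e (w \<bullet> t)\<close>; since \<open>p\<close> is odd,
  \<open>p\<^sup>2\<close> divides \<open>w \<bullet> w'\<close>. As all columns are multiples of \<open>w\<close> modulo \<open>p\<close>, this propagates to all
  pairs of columns.\<close>

section \<open>Inner products of integer vectors modulo the square of a prime\<close>

definition int_dot :: "('n::finite \<Rightarrow> int) \<Rightarrow> ('n \<Rightarrow> int) \<Rightarrow> int" where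
  "int_dot x y = (\<Sum>i\<in>UNIV. x i * y i)"

lemma int_dot_commute: "int_dot x y = int_dot y x"
  by (simp add: int_dot_def mult.commute)

lemma int_dot_combination_right:
  "int_dot x (\<lambda>i. a * y i + b * z i) = a * int_dot x y + b * int_dot x z"
  by (simp add: int_dot_def sum_distrib_left sum.distrib algebra_simps)

lemma int_dot_combination_left:
  "int_dot (\<lambda>i. a * y i + b * z i) x = a * int_dot y x + b * int_dot z x"
  by (metis int_dot_commute int_dot_combination_right)

lemma congruent_vectorE:
  fixes x w :: "'n \<Rightarrow> int"
  assumes "\<forall>i. p dvd x i - c * w i"
  obtains y where "x = (\<lambda>i. c * w i + p * y i)"
proof -
  from assms obtain y where "\<forall>i. x i - c * w i = p * y i"
    unfolding dvd_def by metis
  then have "x = (\<lambda>i. c * w i + p * y i)"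
    by (auto simp: fun_eq_iff algebra_simps)
  then show thesis by (rule that)
qed

text \<open>Substituting \<open>x = c w + p y\<close>, the two conditions on \<open>w\<close> force
  \<open>p\<close> to divide \<open>w \<bullet> y\<close>. Since \<open>a\<close> is a multiple of
  \<open>w\<close> modulo \<open>p\<close>, also \<open>p\<close> divides
  \<open>a \<bullet> y\<close>, so modulo \<open>p\<^sup>2\<close> the product
  \<open>a \<bullet> x\<close> reduces to \<open>c (a \<bullet> w)\<close>.\<close>

lemma square_dvd_int_dot_extend:
  fixes p :: int
  assumes "p \<noteq> 0"
    and x: "\<forall>i. p dvd x i - c * w i" and a: "\<forall>i. p dvd a i - d * w i"
    and wx: "p\<^sup>2 dvd int_dot w x" and ww: "p\<^sup>2 dvd int_dot w w" and aw: "p\<^sup>2 dvd int_dot a w"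
  shows "p\<^sup>2 dvd int_dot a x"
proof -
  obtain y where y: "x = (\<lambda>i. c * w i + p * y i)" using x by (rule congruent_vectorE)
  obtain z where z: "a = (\<lambda>i. d * w i + p * z i)" using a by (rule congruent_vectorE)
  have "int_dot w x = c * int_dot w w + p * int_dot w y"
    by (simp add: y int_dot_combination_right)
  then have "p\<^sup>2 dvd p * int_dot w y"
    using wx ww by (simp add: dvd_add_right_iff)
  then have "p dvd int_dot w y"
    using \<open>p \<noteq> 0\<close> by (simp add: power2_eq_square)
  moreover have "int_dot a y = d * int_dot w y + p * int_dot z y"
    by (simp add: z int_dot_combination_left)
  ultimately have "p dvd int_dot a y" by simp
  then have "p\<^sup>2 dvd p * int_dot a y" by (simp add: power2_eq_square)
  moreover have "int_dot a x = c * int_dot a w + p * int_dot a y"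
    by (simp add: y int_dot_combination_right)
  ultimately show ?thesis using aw by simp
qed

lemma square_dvd_int_dot_unit_multiple:
  fixes p :: int
  assumes "prime p" "odd p" "\<not> p dvd e"
    and x: "\<forall>i. p dvd x i - e * w i"
    and ww: "p\<^sup>2 dvd int_dot w w" and xx: "p\<^sup>2 dvd int_dot x x"
  shows "p\<^sup>2 dvd int_dot w x"
proof -
  obtain t where t: "x = (\<lambda>i. e * w i + p * t i)" using x by (rule congruent_vectorE)
  have wx: "int_dot w x = e * int_dot w w + p * int_dot w t"
    by (simp add: t int_dot_combination_right)
  \<comment> \<open>Both arguments are expanded, and the next line isolates the cross term
    \<open>2 p e (w \<bullet> t)\<close>; all other terms are divisible by
    \<open>p\<^sup>2\<close>.\<close>
  have "int_dot x x = e * (e * int_dot w w + p * int_dot w t)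
      + p * (e * int_dot w t + p * int_dot t t)"
    unfolding t by (simp only: int_dot_combination_right int_dot_combination_left
        int_dot_commute[of t w])
  also have "\<dots> = p * (2 * e * int_dot w t) + (e\<^sup>2 * int_dot w w + p\<^sup>2 * int_dot t t)"
    by (simp add: algebra_simps power2_eq_square)
  finally have "p\<^sup>2 dvd p * (2 * e * int_dot w t) + (e\<^sup>2 * int_dot w w + p\<^sup>2 * int_dot t t)"
    using xx by simp
  moreover have "p\<^sup>2 dvd e\<^sup>2 * int_dot w w + p\<^sup>2 * int_dot t t"
    using ww by simp
  ultimately have "p\<^sup>2 dvd p * (2 * e * int_dot w t)"
    using dvd_add_left_iff by blast
  then have "p dvd 2 * e * int_dot w t"
    using \<open>prime p\<close> by (auto simp: power2_eq_square)
  moreover have "\<not> p dvd 2"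
    using \<open>prime p\<close> \<open>odd p\<close> prime_ge_2_int[of p] zdvd_imp_le[of p 2] by force
  ultimately have "p dvd int_dot w t"
    using \<open>prime p\<close> \<open>\<not> p dvd e\<close> by (simp add: prime_dvd_mult_iff)
  then have "p\<^sup>2 dvd p * int_dot w t" by (simp add: power2_eq_square)
  then show ?thesis using ww by (simp add: wx)
qed

text \<open>This allows a column \<open>w\<close> that does not vanish modulo \<open>p\<close> to
  replace the generator \<open>v\<close>: invert \<open>c\<close> modulo \<open>p\<close> and take
  \<open>e = d b\<close> with \<open>b\<close> the inverse. The second conclusion, read
  contrapositively, says that \<open>e\<close> is a unit whenever \<open>d\<close> is.\<close>

lemma congruent_multiple_of_unit_multiple:
  fixes p :: int
  assumes "prime p" "\<not> p dvd c"
    and w: "\<forall>i. p dvd w i - c * v i" and x: "\<forall>i. p dvd x i - d * v i"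
  obtains e where "\<forall>i. p dvd x i - e * w i" "p dvd e \<Longrightarrow> p dvd d"
proof -
  have "coprime c p"
    using assms(1,2) by (metis coprime_commute prime_imp_coprime)
  then obtain b where "[c * b = 1] (mod p)" using cong_solve_coprime_int by blast
  then have b: "p dvd c * b - 1" by (simp add: cong_iff_dvd_diff)
  have "\<forall>i. p dvd x i - (d * b) * w i"
  proof
    fix i
    \<comment> \<open>The last summand absorbs the error made by treating \<open>c * b\<close> as
      exactly 1, so that all terms in \<open>v\<close> cancel.\<close>
    have "p dvd (x i - d * v i) - d * b * (w i - c * v i) - (c * b - 1) * (d * v i)"
      by (rule dvd_diff[OF dvd_diff[OF x[rule_format] dvd_mult[OF w[rule_format]]] dvd_mult2[OF b]])
    also have "\<dots> = x i - (d * b) * w i" by (simp add: algebra_simps)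
    finally show "p dvd x i - (d * b) * w i" .
  qed
  moreover have "p dvd d" if "p dvd d * b"
  proof -
    have "p dvd (d * b) * c - (c * b - 1) * d"
      by (rule dvd_diff[OF dvd_mult2[OF that] dvd_mult2[OF b]])
    also have "\<dots> = d" by (simp add: algebra_simps)
    finally show ?thesis .
  qed
  ultimately show thesis by (rule that)
qed

lemma square_dvd_int_dot_families:
  fixes p :: int and M M' :: "'n::finite \<Rightarrow> 'n \<Rightarrow> int"
  assumes "prime p" "odd p"
    and M: "\<And>j k. p\<^sup>2 dvd int_dot (M j) (M k)" and M': "\<And>j k. p\<^sup>2 dvd int_dot (M' j) (M' k)"
    and c: "\<And>j. \<forall>i. p dvd M j i - c j * v i" and c': "\<And>j. \<forall>i. p dvd M' j i - c' j * v i"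
    and k: "\<not> p dvd c k" and k': "\<not> p dvd c' k'"
  shows "p\<^sup>2 dvd int_dot (M i) (M' j)"
proof -
  have [simp]: "p \<noteq> 0" using \<open>prime p\<close> by auto
  obtain e where e: "\<forall>i. p dvd M' k' i - e * M k i" "p dvd e \<Longrightarrow> p dvd c' k'"
    by (rule congruent_multiple_of_unit_multiple[OF \<open>prime p\<close> k c[of k] c'[of k']]) (rule that)
  \<comment> \<open>The pivot columns \<open>k\<close> and \<open>k'\<close> come first; then
    \<open>k\<close> is replaced by an arbitrary \<open>i\<close>, and finally \<open>k'\<close> by
    an arbitrary \<open>j\<close>.\<close>
  have kk': "p\<^sup>2 dvd int_dot (M k) (M' k')"
    using assms(1,2) _ e(1) M M'
    by (rule square_dvd_int_dot_unit_multiple) (use e(2) k' in blast)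
  obtain d where d: "\<forall>l. p dvd M i l - d * M k l"
    by (rule congruent_multiple_of_unit_multiple[OF \<open>prime p\<close> k c[of k] c[of i]]) (rule that)
  have ik': "p\<^sup>2 dvd int_dot (M i) (M' k')"
    using square_dvd_int_dot_extend[OF _ e(1) d kk' M M] by simp
  obtain f where f: "\<forall>l. p dvd M i l - f * M' k' l"
    by (rule congruent_multiple_of_unit_multiple[OF \<open>prime p\<close> k' c'[of k'] c[of i]]) (rule that)
  obtain g where g: "\<forall>l. p dvd M' j l - g * M' k' l"
    by (rule congruent_multiple_of_unit_multiple[OF \<open>prime p\<close> k' c'[of k'] c'[of j]]) (rule that)
  show ?thesis
    using square_dvd_int_dot_extend[OF _ g f M' M' ik'] by simp
qed

section \<open>From primitive matrices to integer columns and congruences\<close>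

lemma level_integral:
  fixes Q :: "rat^'n^'n"
  shows "of_nat (level Q) * Q $ i $ j \<in> \<int>"
proof -
  \<comment> \<open>The product of all denominators clears every entry, so the \<open>LEAST\<close>
    in \<open>level\<close> ranges over a nonempty set and its value has the defining
    property.\<close>
  define D where "D = (\<lambda>(i, j). snd (quotient_of (Q $ i $ j)))"
  define k where "k = (\<Prod>x\<in>UNIV. D x)"
  have Dpos: "D x > 0" for x
    by (cases x) (simp add: D_def quotient_of_denom_pos')
  then have kpos: "k > 0" by (simp add: k_def prod_pos)
  have "of_nat (nat k) * Q $ i $ j \<in> \<int>" for i j
  proof -
    obtain a b where ab: "quotient_of (Q $ i $ j) = (a, b)" by force
    have b: "b > 0" using ab by (rule quotient_of_denom_pos)
    have "b = D (i, j)" by (simp add: D_def ab)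
    then have "b dvd k" unfolding k_def by (simp add: dvd_prodI)
    then obtain m where "k = b * m" ..
    then have "of_nat (nat k) * Q $ i $ j = of_int (m * a)"
      using kpos b by (simp add: quotient_of_div[OF ab])
    then show ?thesis by (metis Ints_of_int)
  qed
  then have "\<exists>k>0. \<forall>i j. of_nat k * Q $ i $ j \<in> \<int>"
    using kpos by (intro exI[of _ "nat k"]) auto
  from LeastI_ex[OF this] show ?thesis by (simp add: level_def)
qed

lemma orthogonal_matrix_columns:
  assumes "orthogonal_matrix Q"
  shows "(\<Sum>i\<in>UNIV. Q $ i $ j * Q $ i $ k) = (if j = k then 1 else 0)"
proof -
  have "(transpose Q ** Q) $ j $ k = mat 1 $ j $ k"
    using assms by (simp add: orthogonal_matrix_def)
  then show ?thesis by (simp add: matrix_matrix_mult_def transpose_def mat_def)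
qed

lemma of_int_mod_ring_eq_iff:
  "(of_int a :: 'p::prime_card mod_ring) = of_int b \<longleftrightarrow> int CARD('p) dvd a - b"
  by (simp add: of_int_eq_iff_cong_CHAR cong_iff_dvd_diff)

text \<open>Here \<open>M j\<close> is column \<open>j\<close> of \<open>p Q\<close>, hence the
  swapped indices. Divisibility by \<open>p\<^sup>2\<close> is orthogonality of the columns of
  \<open>Q\<close> after scaling, and the rank condition supplies a column that is a unit multiple
  of \<open>v\<close>.\<close>

lemma primitive_generatedE:
  fixes Q :: "rat^'n^'n"
  assumes prim: "primitive_matrix TYPE('p::prime_card) Q" and gen: "generated_from TYPE('p) Q v"
  obtains M :: "'n \<Rightarrow> 'n \<Rightarrow> int" and c k where
    "\<And>i j. Q $ i $ j = of_int (M j i) / of_nat CARD('p)"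
    "\<And>j k. (int CARD('p))\<^sup>2 dvd int_dot (M j) (M k)"
    "\<And>j. \<forall>i. int CARD('p) dvd M j i - c j * v $ i"
    "\<not> int CARD('p) dvd c k"
proof -
  define S where "S = (scaled_mod Q :: 'p mod_ring^'n^'n)"
  define M where "M = (\<lambda>j i. \<lfloor>of_nat CARD('p) * Q $ i $ j\<rfloor>)"
  have orth: "orthogonal_matrix Q" and lev: "level Q = CARD('p)" and rank: "rank S = 1"
    using prim by (auto simp: primitive_matrix_def S_def)
  have S: "S $ i $ j = of_int (M j i)" for i j
    by (simp add: S_def scaled_mod_def M_def)
  \<comment> \<open>Because \<open>Q\<close> has level \<open>p\<close>, the entries of
    \<open>p Q\<close> are integers and the floor changes nothing.\<close>
  have M: "of_int (M j i) = of_nat CARD('p) * Q $ i $ j" for i j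
    using level_integral[of Q i j] unfolding lev M_def by (metis Ints_cases floor_of_int)
  then have Q: "Q $ i $ j = of_int (M j i) / of_nat CARD('p)" for i j
    by simp
  have dot: "(int CARD('p))\<^sup>2 dvd int_dot (M j) (M k)" for j k
  proof -
    have "(of_int (int_dot (M j) (M k)) :: rat)
        = (of_nat CARD('p))\<^sup>2 * (\<Sum>i\<in>UNIV. Q $ i $ j * Q $ i $ k)"
      by (simp add: int_dot_def M sum_distrib_left power2_eq_square algebra_simps)
    also have "\<dots> = of_int ((int CARD('p))\<^sup>2 * (if j = k then 1 else 0))"
      by (simp add: orthogonal_matrix_columns[OF orth])
    finally have "int_dot (M j) (M k) = (int CARD('p))\<^sup>2 * (if j = k then 1 else 0)"
      unfolding of_int_eq_iff .
    then show ?thesis by simp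
  qed
  have "\<exists>c::int. \<forall>i. int CARD('p) dvd M j i - c * v $ i" for j
  proof -
    obtain c :: "'p mod_ring" where "column j S = c *s (\<chi> i. of_int (v $ i))"
      using gen by (auto simp: generated_from_def S_def)
    then have "S $ i $ j = c * of_int (v $ i)" for i
      by (simp add: column_def vec_eq_iff)
    moreover have "of_int (to_int_mod_ring c) = c"
      by (simp add: of_int_of_int_mod_ring)
    ultimately have "(of_int (M j i) :: 'p mod_ring) = of_int (to_int_mod_ring c * v $ i)" for i
      by (simp flip: S)
    then show ?thesis unfolding of_int_mod_ring_eq_iff by blast
  qed
  then obtain c where c: "\<And>j. \<forall>i. int CARD('p) dvd M j i - c j * v $ i" by metis
  have "\<exists>k. \<not> int CARD('p) dvd c k"
  proof (rule ccontr)
    \<comment> \<open>If every coefficient vanished modulo \<open>p\<close>, then so would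
      \<open>p Q\<close>, and the rank would be 0 instead of 1.\<close>
    assume "\<nexists>k. \<not> int CARD('p) dvd c k"
    then have "int CARD('p) dvd (M j i - c j * v $ i) + c j * v $ i" for i j
      using c[of j] by (intro dvd_add) auto
    then have "int CARD('p) dvd M j i - 0" for i j
      by simp
    then have "S $ i $ j = of_int 0" for i j
      unfolding S of_int_mod_ring_eq_iff by blast
    then have "rows S \<subseteq> {0}" by (auto simp: rows_def row_def vec_eq_iff)
    then have "vec.dim (rows S) = 0" by simp
    then show False using rank by (metis row_rank_def_gen zero_neq_one)
  qed
  then obtain k where "\<not> int CARD('p) dvd c k" ..
  with Q dot c show thesis by (rule that)
qed

section \<open>Integral transition matrices are permutation matrices\<close>

lemma int_vector_sum_squares_one:
  fixes u :: "'n::finite \<Rightarrow> int"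
  assumes "(\<Sum>i\<in>UNIV. u i) = 1" "(\<Sum>i\<in>UNIV. (u i)\<^sup>2) = 1"
  obtains k where "u = (\<lambda>i. if i = k then 1 else 0)"
proof -
  \<comment> \<open>For integers \<open>u\<^sup>2 - u\<close> is never negative and vanishes only at
    0 and 1. Its sum is 1 - 1 = 0, so all entries are 0 or 1, and the entry sum then leaves exactly
    one 1.\<close>
  have nonneg: "0 \<le> (u i)\<^sup>2 - u i" for i
    by (cases "u i \<le> 0") (auto simp: power2_eq_square mult_le_cancel_left1)
  have "(\<Sum>i\<in>UNIV. (u i)\<^sup>2 - u i) = 0"
    using assms by (simp add: sum_subtractf)
  then have "(u i)\<^sup>2 - u i = 0" for i
    using nonneg by (simp add: sum_nonneg_eq_0_iff)
  then have u: "u i = 0 \<or> u i = 1" for i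
    by (auto simp: power2_eq_square)
  have "int (card {i. u i = 1}) = (\<Sum>i\<in>UNIV. if u i = 1 then 1 else 0)"
    by (simp add: sum.If_cases)
  also have "\<dots> = (\<Sum>i\<in>UNIV. u i)" by (rule sum.cong) (use u in auto)
  also have "\<dots> = 1" by (rule assms(1))
  finally have "card {i. u i = 1} = 1" by linarith
  then obtain k where "{i. u i = 1} = {k}" by (rule card_1_singletonE)
  then have "u i = 1 \<longleftrightarrow> i = k" for i by (simp add: set_eq_iff)
  with u have "u i = (if i = k then 1 else 0)" for i by (cases "i = k") auto
  then have "u = (\<lambda>i. if i = k then 1 else 0)" by (rule ext)
  then show thesis by (rule that)
qed

lemma regular_integral_transition_imp_permutation:
  fixes Q Q' :: "rat^'n^'n"
  assumes Q: "orthogonal_matrix Q" "regular_matrix Q"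
    and Q': "orthogonal_matrix Q'" "regular_matrix Q'"
    and int: "\<And>i j. (transpose Q ** Q') $ i $ j \<in> \<int>"
  shows "\<exists>\<sigma>. \<sigma> permutes (UNIV :: 'n set) \<and> Q' = (\<chi> i j. Q $ i $ (\<sigma> j))"
proof -
  define U where "U = transpose Q ** Q'"
  have QU: "Q' = Q ** U"
    using Q(1) by (simp add: U_def orthogonal_matrix_def matrix_mul_assoc)
  have "transpose U ** U = transpose Q' ** (Q ** transpose Q) ** Q'"
    by (simp add: U_def matrix_transpose_mul matrix_mul_assoc)
  also have "\<dots> = mat 1" using Q(1) Q'(1) by (simp add: orthogonal_matrix_def)
  finally have UU: "transpose U ** U = mat 1" .
  \<comment> \<open>The transpose is used because column sums of \<open>U\<close> are wanted.
    Regularity allows \<open>Q *v 1\<close> to be exchanged for \<open>Q' *v 1\<close>, after which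
    \<open>transpose Q'\<close> cancels \<open>Q'\<close>.\<close>
  have "transpose U *v 1 = transpose Q' *v (Q *v 1)"
    by (simp add: U_def matrix_transpose_mul matrix_vector_mul_assoc)
  also have "\<dots> = transpose Q' *v (Q' *v 1)" using Q(2) Q'(2) by (simp add: regular_matrix_def)
  also have "\<dots> = 1"
    using Q'(1) by (simp add: orthogonal_matrix_def matrix_vector_mul_assoc)
  finally have U1: "transpose U *v 1 = 1" .
  have "\<exists>k. \<forall>i. U $ i $ j = (if i = k then 1 else 0)" for j
  proof -
    define u where "u = (\<lambda>i. \<lfloor>U $ i $ j\<rfloor>)"
    have u: "U $ i $ j = of_int (u i)" for i
      using int[of i j] unfolding u_def U_def by (metis Ints_cases floor_of_int)
    have "(\<Sum>i\<in>UNIV. U $ i $ j) = (transpose U *v 1) $ j"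
      unfolding matrix_vector_mult_def by (simp add: transpose_def)
    also have "\<dots> = 1" by (simp only: U1 one_index)
    finally have "of_int (\<Sum>i\<in>UNIV. u i) = (of_int 1 :: rat)" by (simp add: u)
    moreover have "(transpose U ** U) $ j $ j = 1" by (simp add: UU mat_def)
    then have "of_int (\<Sum>i\<in>UNIV. (u i)\<^sup>2) = (of_int 1 :: rat)"
      by (simp add: matrix_matrix_mult_def transpose_def u power2_eq_square)
    ultimately have "(\<Sum>i\<in>UNIV. u i) = 1" "(\<Sum>i\<in>UNIV. (u i)\<^sup>2) = 1"
      unfolding of_int_eq_iff by auto
    then obtain k where "u = (\<lambda>i. if i = k then 1 else 0)"
      by (rule int_vector_sum_squares_one)
    then show ?thesis by (auto simp: u)
  qed
  then obtain \<sigma> where \<sigma>: "\<And>i j. U $ i $ j = (if i = \<sigma> j then 1 else 0)" by metis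
  have Q'_eq: "Q' $ i $ j = Q $ i $ \<sigma> j" for i j
    by (simp add: QU matrix_matrix_mult_def \<sigma> if_distrib cong: if_cong)
  \<comment> \<open>Two indices with the same image would give equal columns of \<open>Q'\<close>,
    whose inner product would be 1 rather than 0.\<close>
  have "inj \<sigma>"
  proof (rule injI, rule ccontr)
    fix j k assume "\<sigma> j = \<sigma> k" "j \<noteq> k"
    then have "(\<Sum>i\<in>UNIV. Q' $ i $ j * Q' $ i $ k) = (\<Sum>i\<in>UNIV. Q' $ i $ j * Q' $ i $ j)"
      by (simp add: Q'_eq)
    then show False using \<open>j \<noteq> k\<close> by (simp add: orthogonal_matrix_columns[OF Q'(1)])
  qed
  then have "\<sigma> permutes UNIV"
    by (intro bij_imp_permutes) (auto simp: bij_def finite_UNIV_inj_surj)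
  then show ?thesis by (auto simp: vec_eq_iff Q'_eq)
qed

theorem theorem2p15:
  fixes v :: "int^'n" and Q :: "rat^'n^'n"
  assumes "odd CARD('p::prime_card)"
    and "primitive_matrix TYPE('p) Q" and "generated_from TYPE('p) Q v"
  shows "\<forall>Q' :: rat^'n^'n.
           primitive_matrix TYPE('p) Q' \<and> generated_from TYPE('p) Q' v \<longrightarrow>
           (\<exists>\<sigma>. \<sigma> permutes (UNIV :: 'n set) \<and> Q' = (\<chi> i j. Q $ i $ (\<sigma> j)))"
proof (intro allI impI, elim conjE)
  fix Q' :: "rat^'n^'n"
  assume Q': "primitive_matrix TYPE('p) Q'" "generated_from TYPE('p) Q' v"
  let ?p = "int CARD('p)"
  have p: "prime ?p" "odd ?p"
    using assms(1) prime_card[where 'a='p] by auto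
  obtain M c k where M: "\<And>i j. Q $ i $ j = of_int (M j i) / of_nat CARD('p)"
    "\<And>j k. ?p\<^sup>2 dvd int_dot (M j) (M k)" "\<And>j. \<forall>i. ?p dvd M j i - c j * v $ i" "\<not> ?p dvd c k"
    using assms(2,3) by (rule primitive_generatedE) (rule that)
  obtain M' c' k' where M': "\<And>i j. Q' $ i $ j = of_int (M' j i) / of_nat CARD('p)"
    "\<And>j k. ?p\<^sup>2 dvd int_dot (M' j) (M' k)" "\<And>j. \<forall>i. ?p dvd M' j i - c' j * v $ i"
    "\<not> ?p dvd c' k'"
    using Q' by (rule primitive_generatedE) (rule that)
  have "(transpose Q ** Q') $ i $ j \<in> \<int>" for i j
  proof -
    have "?p\<^sup>2 dvd int_dot (M i) (M' j)"
      using p M(2) M'(2) M(3) M'(3) M(4) M'(4) by (rule square_dvd_int_dot_families)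
    then obtain m where "int_dot (M i) (M' j) = ?p\<^sup>2 * m" ..
    then have m: "(of_int (int_dot (M i) (M' j)) :: rat) = of_int (?p\<^sup>2 * m)" by (rule arg_cong)
    \<comment> \<open>Each factor contributes one denominator \<open>p\<close>, so divisibility by
      \<open>p\<^sup>2\<close> is exactly what integrality requires.\<close>
    have "(transpose Q ** Q') $ i $ j = of_int (int_dot (M i) (M' j)) / (of_nat CARD('p))\<^sup>2"
      by (simp add: matrix_matrix_mult_def transpose_def M(1) M'(1) int_dot_def
          sum_divide_distrib power2_eq_square)
    also have "\<dots> = of_int m" by (simp add: m)
    finally show ?thesis by simp
  qed
  moreover have "orthogonal_matrix Q" "regular_matrix Q" "orthogonal_matrix Q'" "regular_matrix Q'"
    using assms(2) Q'(1) by (simp_all add: primitive_matrix_def)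
  ultimately show "\<exists>\<sigma>. \<sigma> permutes (UNIV :: 'n set) \<and> Q' = (\<chi> i j. Q $ i $ (\<sigma> j))"
    by (intro regular_integral_transition_imp_permutation)
qed

end
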